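(* Identify $\mathcal{P}(\mathbb{N})$ with the Cantor space $\{0,1\}^{\mathbb{N}}$ (product topology). For each $\alpha\in(0,\tfrac13)$, the family $\Sigma(\mathcal{Z}_\alpha)$ is a comeager subset of $\mathcal{P}(\mathbb{N})$. That is, for comeager many $A\subseteq\mathbb{N}$ there do not exist $B,C\subseteq\mathbb{N}$ with $|B|,|C|\ge 2$ such that $\lim_{n\to\infty} |(A\bigtriangleup(B+C))\cap[0,n]|/n^\alpha=0$.
   Context: $\mathbb{N}$ denotes the set of nonnegative integers; $B+C:=\{b+c: b\in B, c\in C\}$. For $\alpha\in(0,1]$, $\mathcal{Z}_\alpha:=\{S\subseteq\mathbb{N}: \lim_{n\to\infty}|S\cap[0,n]|/n^\alpha=0\}$. For a family $\mathcal{I}\subseteq\mathcal{P}(\mathbb{N})$ closed under finite unions and subsets, a set $A\subseteq\mathbb{N}$ is $\mathcal{I}$-irreducible if there are no $B,C\subseteq\mathbb{N}$ with $|B|,|C|\ge 2$ and $A\bigtriangleup(B+C)\in\mathcal{I}$; $\Sigma(\mathcal{I})$ denotes the family of $\mathcal{I}$-irreducible sets. A subset of a topological space is comeager if its complement is contained in a countable union of closed sets with empty interior. *)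

theory Defs
  imports "HOL-Analysis.Analysis"
begin

definition comeager_in :: "'a topology \<Rightarrow> 'a set \<Rightarrow> bool" where
  "comeager_in X S \<longleftrightarrow> S \<subseteq> topspace X \<and>
     (\<exists>\<F>. countable \<F> \<and> (\<forall>F\<in>\<F>. closedin X F \<and> X interior_of F = {}) \<and>
          topspace X - S \<subseteq> \<Union>\<F>)"

text \<open>The power set of the naturals carries the topology of the Cantor space, transported along
  the bijection sending a set to its characteristic function.\<close>

definition cantor_powerset :: "nat set topology" where
  "cantor_powerset = pullback_topology UNIV (\<lambda>A n. n \<in> A)
     (product_topology (\<lambda>_. discrete_topology (UNIV :: bool set)) UNIV)"

lemma homeomorphic_map_cantor_powerset:
  "homeomorphic_map cantor_powerset
     (product_topology (\<lambda>_. discrete_topology (UNIV :: bool set)) UNIV) (\<lambda>A n. n \<in> A)"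
proof -
  let ?P = "product_topology (\<lambda>_::nat. discrete_topology (UNIV :: bool set)) UNIV"
  have top: "topspace ?P = UNIV" by (simp add: topspace_product_topology)
  have 1: "continuous_map cantor_powerset ?P (\<lambda>A n. n \<in> A)"
    using continuous_map_pullback[OF continuous_map_id, of UNIV "\<lambda>A n. n \<in> A"]
    by (simp add: cantor_powerset_def comp_def)
  have 2: "continuous_map ?P cantor_powerset Collect"
    unfolding cantor_powerset_def
    by (rule continuous_map_pullback') (simp_all add: comp_def)
  show ?thesis
    unfolding homeomorphic_map_maps homeomorphic_maps_def
    using 1 2 by (intro exI[of _ Collect]) auto
qed

text \<open>The term for \<open>n = 0\<close> is \<open>0\<close> here because of division by zero; it does not affect the limit.\<close>

definition Z_ideal :: "real \<Rightarrow> nat set set" where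
  "Z_ideal \<alpha> = {S. (\<lambda>n. real (card (S \<inter> {0..n})) / real n powr \<alpha>) \<longlonglongrightarrow> 0}"

text \<open>Sumsets \<open>B + C\<close> are those of \<open>HOL-Library.Set_Algebras\<close>. As \<open>card\<close> is \<open>0\<close> on infinite
  sets, having at least two elements is written with an explicit disjunct for infinite sets.\<close>

definition irreducible_mod :: "nat set set \<Rightarrow> nat set \<Rightarrow> bool" where
  "irreducible_mod \<I> A \<longleftrightarrow>
     \<not> (\<exists>B C. (infinite B \<or> card B \<ge> 2) \<and> (infinite C \<or> card C \<ge> 2) \<and>
             sym_diff A (B + C) \<in> \<I>)"

definition Irreducibles :: "nat set set \<Rightarrow> nat set set" where
  "Irreducibles \<I> = {A. irreducible_mod \<I> A}"

lemma Z_ideal_subset: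
  assumes "S \<in> Z_ideal \<alpha>" "T \<subseteq> S"
  shows "T \<in> Z_ideal \<alpha>"
proof -
  have "(\<lambda>n. real (card (T \<inter> {0..n})) / real n powr \<alpha>) \<longlonglongrightarrow> 0"
  proof (rule tendsto_sandwich[OF _ _ tendsto_const])
    show "(\<lambda>n. real (card (S \<inter> {0..n})) / real n powr \<alpha>) \<longlonglongrightarrow> 0"
      using assms(1) by (simp add: Z_ideal_def)
    show "\<forall>\<^sub>F n in sequentially. real (card (T \<inter> {0..n})) / real n powr \<alpha>
            \<le> real (card (S \<inter> {0..n})) / real n powr \<alpha>"
      using assms(2) by (intro always_eventually allI divide_right_mono) (auto intro!: card_mono)
  qed simp
  then show ?thesis by (simp add: Z_ideal_def)
qed

lemma Z_ideal_Un:
  assumes "S \<in> Z_ideal \<alpha>" "T \<in> Z_ideal \<alpha>"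
  shows "S \<union> T \<in> Z_ideal \<alpha>"
proof -
  have "(\<lambda>n. real (card ((S \<union> T) \<inter> {0..n})) / real n powr \<alpha>) \<longlonglongrightarrow> 0"
  proof (rule tendsto_sandwich[OF _ _ tendsto_const])
    show "(\<lambda>n. real (card (S \<inter> {0..n})) / real n powr \<alpha>
             + real (card (T \<inter> {0..n})) / real n powr \<alpha>) \<longlonglongrightarrow> 0"
      using assms tendsto_add[of _ 0 sequentially _ 0] by (simp add: Z_ideal_def)
    have "card ((S \<union> T) \<inter> {0..n}) \<le> card (S \<inter> {0..n}) + card (T \<inter> {0..n})" for n
      by (metis card_Un_le Int_Un_distrib2)
    then have "real (card ((S \<union> T) \<inter> {0..n}))
        \<le> real (card (S \<inter> {0..n})) + real (card (T \<inter> {0..n}))" for n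
      by (metis of_nat_add of_nat_le_iff)
    then show "\<forall>\<^sub>F n in sequentially. real (card ((S \<union> T) \<inter> {0..n})) / real n powr \<alpha>
            \<le> real (card (S \<inter> {0..n})) / real n powr \<alpha> + real (card (T \<inter> {0..n})) / real n powr \<alpha>"
      unfolding add_divide_distrib[symmetric]
      by (intro always_eventually allI divide_right_mono) auto
  qed simp
  then show ?thesis by (simp add: Z_ideal_def)
qed

end

theory Submission
  imports Defs
begin

text \<open>A generic \<open>A\<close> coincides on \<open>[p, p\<^sup>9]\<close> with the multiples of \<open>p\<close>, for infinitely many \<open>p\<close>.
  Fix distinct \<open>c\<^sub>1, c\<^sub>2 \<in> C\<close> and take \<open>p\<close> larger than both. For \<open>b \<in> B\<close> the numbers \<open>b + c\<^sub>1\<close> and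
  \<open>b + c\<^sub>2\<close> of \<open>B + C\<close> are closer than \<open>p\<close>, so one of them is an error, i.e. belongs to
  \<open>A \<triangle> (B + C)\<close>. Hence \<open>K\<close> errors leave room for at most \<open>2K + p\<close> elements of \<open>B\<close>, likewise of \<open>C\<close>,
  and \<open>B + C\<close> covers at most \<open>(2K + p)\<^sup>2\<close> of the roughly \<open>p\<^sup>8\<close> multiples. So \<open>K\<close> is at least of order \<open>p\<^sup>4\<close>,
  whereas membership in the ideal forces \<open>K < p\<^sup>3\<close>.\<close>

text \<open>A basic open set of the product constrains finitely many coordinates, all below some
  \<open>m\<close>; conversely, prescribing the first \<open>m\<close> coordinates gives a basic
  open set. Openness thus becomes a statement about finite initial segments.\<close>

lemma openin_cantor_powerset_iff:
  "openin cantor_powerset W \<longleftrightarrow>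
    (\<forall>A\<in>W. \<exists>m. \<forall>A'. (\<forall>n<m. n \<in> A' \<longleftrightarrow> n \<in> A) \<longrightarrow> A' \<in> W)"
proof
  assume "openin cantor_powerset W"
  then obtain V where V: "openin (product_topology (\<lambda>_. discrete_topology (UNIV :: bool set)) UNIV) V"
    and W: "W = (\<lambda>A n. n \<in> A) -` V"
    unfolding cantor_powerset_def openin_pullback_topology by auto
  show "\<forall>A\<in>W. \<exists>m. \<forall>A'. (\<forall>n<m. n \<in> A' \<longleftrightarrow> n \<in> A) \<longrightarrow> A' \<in> W"
  proof
    fix A assume "A \<in> W"
    then have "(\<lambda>n. n \<in> A) \<in> V" by (simp add: W)
    then obtain U where fin: "finite {n. U n \<noteq> UNIV}" and A: "\<forall>n. (n \<in> A) \<in> U n"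
      and sub: "Pi\<^sub>E UNIV U \<subseteq> V"
      using V unfolding openin_product_topology_alt by (fastforce simp: PiE_iff)
    from fin obtain m where m: "\<forall>n\<in>{n. U n \<noteq> UNIV}. n < m"
      using finite_nat_set_iff_bounded by blast
    have "A' \<in> W" if "\<forall>n<m. n \<in> A' \<longleftrightarrow> n \<in> A" for A'
    proof -
      have "(n \<in> A') \<in> U n" for n
        using A m that by (cases "U n = UNIV") auto
      then show ?thesis using sub by (auto simp: W PiE_iff)
    qed
    then show "\<exists>m. \<forall>A'. (\<forall>n<m. n \<in> A' \<longleftrightarrow> n \<in> A) \<longrightarrow> A' \<in> W" by blast
  qed
next
  assume R: "\<forall>A\<in>W. \<exists>m. \<forall>A'. (\<forall>n<m. n \<in> A' \<longleftrightarrow> n \<in> A) \<longrightarrow> A' \<in> W"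
  let ?V = "{f. Collect f \<in> W}"
  have "openin (product_topology (\<lambda>_. discrete_topology (UNIV :: bool set)) UNIV) ?V"
    unfolding openin_product_topology_alt
  proof
    fix f assume "f \<in> ?V"
    then have "Collect f \<in> W" by simp
    with R have "\<exists>m. \<forall>A'. (\<forall>n<m. n \<in> A' \<longleftrightarrow> n \<in> Collect f) \<longrightarrow> A' \<in> W" by (rule bspec)
    then obtain m where m: "\<And>A'. (\<forall>n<m. n \<in> A' \<longleftrightarrow> f n) \<Longrightarrow> A' \<in> W"
      unfolding mem_Collect_eq by blast
    let ?U = "\<lambda>n. if n < m then {f n} else UNIV"
    have "finite {n. ?U n \<noteq> UNIV}"
      by (rule finite_subset[of _ "{..<m}"]) auto
    moreover have "Pi\<^sub>E UNIV ?U \<subseteq> ?V"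
    proof
      fix g assume g: "g \<in> Pi\<^sub>E UNIV ?U"
      have "g n = f n" if "n < m" for n
        using PiE_mem[OF g, of n] that by simp
      then show "g \<in> ?V" by (auto intro!: m)
    qed
    ultimately show "\<exists>U. finite {i \<in> UNIV. U i \<noteq> topspace (discrete_topology (UNIV :: bool set))} \<and>
        (\<forall>i\<in>UNIV. openin (discrete_topology (UNIV :: bool set)) (U i)) \<and> f \<in> Pi\<^sub>E UNIV U \<and> Pi\<^sub>E UNIV U \<subseteq> ?V"
      by (intro exI[of _ ?U]) (auto simp: PiE_iff)
  qed
  moreover have "W = (\<lambda>A n. n \<in> A) -` ?V" by auto
  ultimately show "openin cantor_powerset W"
    unfolding cantor_powerset_def openin_pullback_topology by auto
qed

lemma topspace_cantor_powerset [simp]: "topspace cantor_powerset = UNIV"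
  using openin_cantor_powerset_iff[of UNIV] openin_subset by blast

text \<open>For fixed \<open>k\<close> the condition is open, since one finite window witnesses it,
  and dense, since any finite initial segment can be continued by a suitable window. The complements
  over all \<open>k\<close> are the countably many closed sets with empty interior.\<close>

lemma comeager_in_multiples_windows:
  fixes f :: "nat \<Rightarrow> nat"
  shows "comeager_in cantor_powerset {A. \<forall>k. \<exists>p\<ge>k. \<forall>x\<in>{p..f p}. x \<in> A \<longleftrightarrow> p dvd x}"
proof -
  define U where "U k = {A. \<exists>p\<ge>k. \<forall>x\<in>{p..f p}. x \<in> A \<longleftrightarrow> p dvd x}" for k
  have "openin cantor_powerset (U k)" for k
    unfolding openin_cantor_powerset_iff
  proof
    fix A assume "A \<in> U k"
    then obtain p where "p \<ge> k" "\<forall>x\<in>{p..f p}. x \<in> A \<longleftrightarrow> p dvd x" by (auto simp: U_def)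
    then have "A' \<in> U k" if "\<forall>n<Suc (f p). n \<in> A' \<longleftrightarrow> n \<in> A" for A'
      using that unfolding U_def by auto
    then show "\<exists>m. \<forall>A'. (\<forall>n<m. n \<in> A' \<longleftrightarrow> n \<in> A) \<longrightarrow> A' \<in> U k" by blast
  qed
  then have clo: "closedin cantor_powerset (- U k)" for k
    by (simp add: closedin_def Compl_eq_Diff_UNIV[symmetric])
  have "W = {}" if W: "openin cantor_powerset W" "W \<subseteq> - U k" for W k
  proof (rule ccontr)
    assume "W \<noteq> {}"
    then obtain A where "A \<in> W" by blast
    then obtain m where m: "\<And>A'. (\<forall>n<m. n \<in> A' \<longleftrightarrow> n \<in> A) \<Longrightarrow> A' \<in> W"
      using W(1) unfolding openin_cantor_powerset_iff by meson
    \<comment> \<open>The modulus is at least \<open>k\<close>, as \<open>U k\<close> demands, and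
      at least \<open>m\<close>, so the window starts only after the segment copied from
      \<open>A\<close>.\<close>
    define A' where "A' = {x. if x < m then x \<in> A else max k m dvd x}"
    have "A' \<in> W" by (rule m) (simp add: A'_def)
    moreover have "A' \<in> U k"
      unfolding U_def A'_def by (auto intro!: exI[of _ "max k m"])
    ultimately show False using W(2) by blast
  qed
  then have int: "cantor_powerset interior_of (- U k) = {}" for k
    using openin_interior_of interior_of_subset by metis
  show ?thesis
    unfolding comeager_in_def
    by (intro conjI exI[of _ "range (\<lambda>k. - U k)"]) (auto simp: clo int, auto simp: U_def)
qed

lemma obtain_two_elements:
  assumes "infinite B \<or> card B \<ge> 2"
  obtains x y where "x \<in> B" "y \<in> B" "x \<noteq> y"
proof -
  have "\<not> is_singleton B" "B \<noteq> {}"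
    using assms by (auto simp: is_singleton_altdef)
  then show thesis using that by (metis is_singletonI')
qed

lemma no_two_close_multiples:
  fixes p :: nat
  assumes "p dvd b + x" "p dvd b + y" "x < p" "y < p"
  shows "x = y"
proof -
  \<comment> \<open>Natural subtraction truncates, so both differences are considered: each is a
    multiple of \<open>p\<close> below \<open>p\<close>, hence 0.\<close>
  have "p dvd x - y" "p dvd y - x"
    using dvd_diff_nat[OF assms(1,2)] dvd_diff_nat[OF assms(2,1)] by simp_all
  then show ?thesis using assms(3,4) dvd_imp_le[of p "x - y"] dvd_imp_le[of p "y - x"] by linarith
qed

lemma card_summand_le:
  fixes B C A :: "nat set"
  assumes A: "\<forall>x\<in>{p..N}. x \<in> A \<longleftrightarrow> p dvd x"
    and c: "c1 \<in> C" "c2 \<in> C" "c1 \<noteq> c2" "c1 < p" "c2 < p"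
    and "p \<le> N"
  shows "card (B \<inter> {0..N - p}) \<le> 2 * card (sym_diff A (B + C) \<inter> {0..N}) + p"
proof -
  let ?S = "sym_diff A (B + C) \<inter> {0..N}"
  \<comment> \<open>Elements below \<open>p\<close> may miss the window and cost the term
    \<open>p\<close>. Any other \<open>b\<close> is recovered from an error by subtracting
    \<open>c1\<close> or \<open>c2\<close>, whence the factor 2. The cut at \<open>N - p\<close>
    keeps \<open>b + c1\<close> and \<open>b + c2\<close> at most \<open>N\<close>.\<close>
  have "B \<inter> {0..N - p} \<subseteq> {..<p} \<union> ((\<lambda>e. e - c1) ` ?S \<union> (\<lambda>e. e - c2) ` ?S)"
  proof
    fix b assume b: "b \<in> B \<inter> {0..N - p}"
    have "b + c1 \<in> ?S \<or> b + c2 \<in> ?S" if "p \<le> b"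
    proof -
      have "b + c1 \<in> B + C" "b + c2 \<in> B + C" using b c by (auto intro: set_plus_intro)
      moreover have "b + c1 \<in> {p..N}" "b + c2 \<in> {p..N}" using b c that \<open>p \<le> N\<close> by auto
      moreover have "\<not> (p dvd b + c1 \<and> p dvd b + c2)"
        using no_two_close_multiples c by blast
      ultimately show ?thesis using A by auto
    qed
    moreover have "b \<in> (\<lambda>e. e - c) ` ?S" if "b + c \<in> ?S" for c
      using that by (rule rev_image_eqI) simp
    ultimately show "b \<in> {..<p} \<union> ((\<lambda>e. e - c1) ` ?S \<union> (\<lambda>e. e - c2) ` ?S)"
      by (metis UnCI lessThan_iff not_le)
  qed
  then have "card (B \<inter> {0..N - p}) \<le> card ({..<p} \<union> ((\<lambda>e. e - c1) ` ?S \<union> (\<lambda>e. e - c2) ` ?S))"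
    by (intro card_mono) auto
  also have "\<dots> \<le> p + (card ?S + card ?S)"
    by (intro order_trans[OF card_Un_le] add_mono card_image_le) auto
  finally show ?thesis by simp
qed

lemma card_multiples_le:
  fixes B C A :: "nat set"
  assumes A: "\<forall>x\<in>{p..p * T}. x \<in> A \<longleftrightarrow> p dvd x" and "T > 0"
    and b: "b1 \<in> B" "b2 \<in> B" "b1 \<noteq> b2" "b1 < p" "b2 < p"
    and c: "c1 \<in> C" "c2 \<in> C" "c1 \<noteq> c2" "c1 < p" "c2 < p"
    and K: "card (sym_diff A (B + C) \<inter> {0..p * T}) \<le> K"
  shows "T - 1 \<le> K + (2 * K + p)\<^sup>2"
proof -
  let ?N = "p * T"
  let ?S = "sym_diff A (B + C) \<inter> {0..?N}"
  let ?B = "B \<inter> {0..?N - p}" and ?C = "C \<inter> {0..?N - p}"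
  have N: "p \<le> ?N" using \<open>T > 0\<close> by simp
  have cB: "card ?B \<le> 2 * K + p"
    using card_summand_le[OF A c N, of B] K by linarith
  have cC: "card ?C \<le> 2 * K + p"
    using card_summand_le[OF A b N, of C] K by (simp add: add.commute[of C B])
  \<comment> \<open>The multiple \<open>p * T\<close> is left out: the others are at most
    \<open>?N - p\<close>, and so are the summands of any representation in \<open>B + C\<close>,
    which is the range where \<open>card_summand_le\<close> counts.\<close>
  have "(*) p ` {1..<T} \<subseteq> ?S \<union> (?B + ?C)"
  proof
    fix x assume "x \<in> (*) p ` {1..<T}"
    then obtain t where "x = p * t" "t \<in> {1..<T}" by (rule imageE)
    then have t: "x = p * t" "1 \<le> t" "t < T" by simp_all
    have "p * (t + 1) \<le> p * T" using t by (intro mult_left_mono) auto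
    then have x: "p \<le> x" "x \<le> ?N - p" using t by auto
    then have "x \<in> A" using A t by auto
    show "x \<in> ?S \<union> (?B + ?C)"
    proof (cases "x \<in> B + C")
      case True
      then obtain \<beta> \<gamma> where "x = \<beta> + \<gamma>" "\<beta> \<in> B" "\<gamma> \<in> C" by (auto elim: set_plus_elim)
      then have "x \<in> ?B + ?C" using x by auto
      then show ?thesis ..
    next
      case False
      then show ?thesis using \<open>x \<in> A\<close> x by auto
    qed
  qed
  moreover have fin: "finite (?B + ?C)" by (intro finite_set_plus) auto
  ultimately have "card ((*) p ` {1..<T}) \<le> card (?S \<union> (?B + ?C))"
    by (intro card_mono) auto
  also have "\<dots> \<le> card ?S + card (?B + ?C)" by (rule card_Un_le)
  also have "card (?B + ?C) \<le> card ?B * card ?C"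
    unfolding set_plus_image using card_image_le[of "?B \<times> ?C"] by (simp add: card_cartesian_product)
  also have "\<dots> \<le> (2 * K + p) * (2 * K + p)" using cB cC by (rule mult_mono) auto
  finally have "card ((*) p ` {1..<T}) \<le> K + (2 * K + p)\<^sup>2"
    using K by (simp add: power2_eq_square)
  moreover have "card ((*) p ` {1..<T}) = T - 1"
    using b by (subst card_image) (auto intro: inj_onI)
  ultimately show ?thesis by simp
qed

text \<open>The quotient in the limit is eventually below 1, and the cube root of
  \<open>p ^ 9\<close> is \<open>p ^ 3\<close>.\<close>

lemma Z_ideal_card_less:
  assumes "S \<in> Z_ideal \<alpha>" "\<alpha> \<le> 1/3"
  obtains M where "\<And>p. p \<ge> M \<Longrightarrow> card (S \<inter> {0..p ^ 9}) < p ^ 3"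
proof -
  from assms(1) have "\<forall>\<^sub>F n in sequentially. real (card (S \<inter> {0..n})) / real n powr \<alpha> < 1"
    unfolding Z_ideal_def by (auto intro: order_tendstoD)
  then obtain M where M: "\<And>n. n \<ge> M \<Longrightarrow> real (card (S \<inter> {0..n})) / real n powr \<alpha> < 1"
    unfolding eventually_sequentially by blast
  show thesis
  proof (rule that)
    fix p assume p: "p \<ge> max 1 M"
    have "p ^ 1 \<le> p ^ 9" using p by (intro power_increasing) auto
    then have "real (card (S \<inter> {0..p ^ 9})) < real (p ^ 9) powr \<alpha>"
      using M[of "p ^ 9"] p by (simp add: divide_less_eq)
    also have "\<dots> \<le> real (p ^ 9) powr (1/3)"
      using p assms(2) by (intro powr_mono) auto
    also have "\<dots> = (real p powr 9) powr (1/3)"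
      using p by (simp add: powr_numeral)
    also have "\<dots> = real (p ^ 3)"
      using p unfolding powr_powr by (simp add: powr_numeral)
    finally show "card (S \<inter> {0..p ^ 9}) < p ^ 3" by (simp only: of_nat_less_iff)
  qed
qed

text \<open>For windows ending at p^e the count compares about p^(e-1) multiples with a constant
  times (p^(e/3))^2 sums, so e has to exceed 3. The choice e = 9 also makes e/3 an integer.\<close>

lemma irreducible_mod_Z_ideal:
  assumes "\<alpha> \<le> 1/3" and A: "\<forall>k. \<exists>p\<ge>k. \<forall>x\<in>{p..p ^ 9}. x \<in> A \<longleftrightarrow> p dvd x"
  shows "irreducible_mod (Z_ideal \<alpha>) A"
  unfolding irreducible_mod_def
proof (intro notI, elim exE conjE)
  fix B C :: "nat set"
  assume "infinite B \<or> 2 \<le> card B" "infinite C \<or> 2 \<le> card C"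
  then obtain b1 b2 c1 c2 where bc: "b1 \<in> B" "b2 \<in> B" "b1 \<noteq> b2" "c1 \<in> C" "c2 \<in> C" "c1 \<noteq> c2"
    by (metis obtain_two_elements)
  assume "sym_diff A (B + C) \<in> Z_ideal \<alpha>"
  then obtain M where M: "\<And>p. p \<ge> M \<Longrightarrow> card (sym_diff A (B + C) \<inter> {0..p ^ 9}) < p ^ 3"
    using Z_ideal_card_less assms(1) by blast
  \<comment> \<open>The bound puts the four chosen elements below \<open>p\<close> and makes the
    error estimate available; the summand 4 ensures 5 \<le> p, so that p^2 \<ge> 25 beats the
    constant 10 with the extra 1 absorbed.\<close>
  obtain p where p: "p \<ge> Suc (M + b1 + b2 + c1 + c2 + 4)"
    and Ap: "\<forall>x\<in>{p..p ^ 9}. x \<in> A \<longleftrightarrow> p dvd x"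
    using A by blast
  have N: "p * p ^ 8 = p ^ 9" by (simp add: power_Suc[symmetric])
  have "card (sym_diff A (B + C) \<inter> {0..p * p ^ 8}) \<le> p ^ 3"
    using M[of p] p by (simp add: N)
  then have "p ^ 8 - 1 \<le> p ^ 3 + (2 * p ^ 3 + p)\<^sup>2"
    using p bc Ap by (intro card_multiples_le[of p "p ^ 8" A b1 B b2 c1 C c2]) (auto simp: N)
  also have "\<dots> \<le> p ^ 6 + (2 * p ^ 3 + p ^ 3)\<^sup>2"
    using p self_le_power[of p 3]
    by (intro add_mono power_mono power_increasing order_refl) auto
  also have "\<dots> = 10 * p ^ 6" by (simp add: power_mult_distrib)
  finally have "p ^ 8 \<le> 10 * p ^ 6 + 1" by simp
  also have "\<dots> < 25 * p ^ 6" using one_le_power[of p 6] p by linarith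
  also have "\<dots> \<le> p\<^sup>2 * p ^ 6"
    using power_mono[of 5 p 2] p by (intro mult_right_mono) auto
  also have "\<dots> = p ^ 8" by (simp add: power_add[symmetric])
  finally show False by simp
qed

lemma comeager_in_mono:
  assumes "comeager_in X S" "S \<subseteq> T" "T \<subseteq> topspace X"
  shows "comeager_in X T"
  using assms unfolding comeager_in_def by (meson Diff_mono order_refl order_trans)

theorem theorem1p4:
  fixes \<alpha> :: real
  assumes "0 < \<alpha>" and "\<alpha> < 1/3"
  shows "comeager_in cantor_powerset (Irreducibles (Z_ideal \<alpha>))"
  by (rule comeager_in_mono[OF comeager_in_multiples_windows[of "\<lambda>p. p ^ 9"]])
    (use assms in \<open>auto simp: Irreducibles_def intro: irreducible_mod_Z_ideal\<close>)

end
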